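(* Let $x$ and $y$ be conjugate involutions in $\mathrm{Sym}(n)$, both of minimal length in their conjugacy class in $\mathrm{Sym}(n)$. Then $|\Delta_1(x)|=|\Delta_1(y)|$.
   Context: $\mathrm{Sym}(n)$ is regarded as the Coxeter group of type $\mathrm{A}_{n-1}$ with fundamental reflections the adjacent transpositions $(i,i+1)$, $1\le i\le n-1$, and corresponding length function $\ell$. $\mathcal{I}(\mathrm{Sym}(n))$ is the set of elements of order exactly $2$, and involutions are elements of this set. For $x\in\mathcal{I}(\mathrm{Sym}(n))$, $\Delta_1(x)=\{z\in\mathcal{I}(\mathrm{Sym}(n)) : \ell(xz)=\ell(x)+\ell(z)\}$. *)

theory Defs
  imports "HOL-Algebra.Sym_Groups" "HOL-Algebra.Multiplicative_Group"
begin

definition involutions :: "('a, 'b) monoid_scheme \<Rightarrow> 'a set"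
  where "involutions G = {x \<in> carrier G. group.ord G x = 2}"

definition conj_class :: "('a, 'b) monoid_scheme \<Rightarrow> 'a \<Rightarrow> 'a set"
  where "conj_class G x = {g \<otimes>\<^bsub>G\<^esub> x \<otimes>\<^bsub>G\<^esub> inv\<^bsub>G\<^esub> g | g. g \<in> carrier G}"

text \<open>
  Length of a shortest word in \<open>S\<close> with value \<open>g\<close>. Inverses of letters are not needed, since this
  is only used for a set \<open>S\<close> of involutions. The value is unspecified if \<open>g\<close> is not a product of
  elements of \<open>S\<close>.
\<close>

definition word_length :: "('a, 'b) monoid_scheme \<Rightarrow> 'a set \<Rightarrow> 'a \<Rightarrow> nat"
  where "word_length G S g =
    (LEAST k. \<exists>ws. length ws = k \<and> set ws \<subseteq> S \<and> foldr (mult G) ws \<one>\<^bsub>G\<^esub> = g)"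

definition adj_transpositions :: "nat \<Rightarrow> (nat \<Rightarrow> nat) set"
  where "adj_transpositions n = {transpose i (i + 1) | i. 1 \<le> i \<and> i < n}"

definition cox_length :: "nat \<Rightarrow> (nat \<Rightarrow> nat) \<Rightarrow> nat"
  where "cox_length n = word_length (sym_group n) (adj_transpositions n)"

text \<open>
  Multiplication in \<^const>\<open>sym_group\<close> composes permutations from right to left. The opposite convention gives the same
  set, since for involutions \<open>z \<circ> x\<close> is the inverse of \<open>x \<circ> z\<close> and so has the same length.
\<close>

definition Delta1 :: "nat \<Rightarrow> (nat \<Rightarrow> nat) \<Rightarrow> (nat \<Rightarrow> nat) set"
  where "Delta1 n x = {z \<in> involutions (sym_group n).
    cox_length n (x \<otimes>\<^bsub>sym_group n\<^esub> z) = cox_length n x + cox_length n z}"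

definition min_length_in_class :: "nat \<Rightarrow> (nat \<Rightarrow> nat) \<Rightarrow> bool"
  where "min_length_in_class n x \<longleftrightarrow>
    is_arg_min (cox_length n) (\<lambda>z. z \<in> conj_class (sym_group n) x) x"

end

theory Submission
  imports Defs
begin

text \<open>
  An involution \<open>x\<close> of minimal length is a product of disjoint adjacent transpositions. Counting
  inversions, \<open>\<ell>(xz) = \<ell>(x) + \<ell>(z)\<close> holds for an involution \<open>z\<close> iff \<open>z\<close> is increasing on every pair
  swapped by \<open>x\<close>. Let \<open>W\<^sub>x\<close> be the group of permutations that map each point to itself or to its
  image under \<open>x\<close>. Every double coset of \<open>W\<^sub>x\<close> contains exactly one \<open>z\<close> such that \<open>z\<close> and its
  inverse are increasing on these pairs, and this \<open>z\<close> squares to the identity iff the double coset is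
  closed under inversion. So \<open>|\<Delta>\<^sub>1(x)| + 1\<close> is the number of double cosets of \<open>W\<^sub>x\<close> closed
  under inversion. If \<open>h\<close> conjugates \<open>x\<close> to \<open>y\<close>, it conjugates \<open>W\<^sub>x\<close> to \<open>W\<^sub>y\<close>, so this number is
  the same for \<open>x\<close> and \<open>y\<close>.
\<close>

section \<open>Length and inversions\<close>

text \<open>The pairs range over all natural numbers, which keeps \<open>n\<close> out of the
  definition. For a permutation of \<open>{1..n}\<close> nothing is gained outside
  \<open>{1..n}\<close>.\<close>

definition inversions :: "(nat \<Rightarrow> nat) \<Rightarrow> (nat \<times> nat) set"
  where "inversions w = {(i, j). i < j \<and> w j < w i}"

text \<open>Applied to \<open>x p\<close>, the bound also gives \<open>p \<le> Suc (x p)\<close>, so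
  every point moves by at most one. These are the products of disjoint adjacent transpositions,
  \<open>id\<close> included.\<close>

definition adjacent_involution :: "nat \<Rightarrow> (nat \<Rightarrow> nat) \<Rightarrow> bool"
  where "adjacent_involution n x \<longleftrightarrow> x permutes {1..n} \<and> (\<forall>p. x (x p) = p) \<and> (\<forall>p. x p \<le> Suc p)"

lemma inversions_subset:
  assumes "w permutes {1..n}"
  shows "inversions w \<subseteq> {1..n} \<times> {1..n}"
proof (clarify, rule ccontr)
  fix i j assume ij: "(i, j) \<in> inversions w" and out: "\<not> (i \<in> {1..n} \<and> j \<in> {1..n})"
  then have lt: "i < j" "w j < w i"
    by (auto simp: inversions_def)
  consider "i \<notin> {1..n}" | "i \<in> {1..n}" "j \<notin> {1..n}"
    using out by blast
  then show False
  proof cases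
    case 1
    then have "w i = i" by (rule permutes_not_in[OF assms])
    with lt 1 have "i > n" by (cases "i = 0") auto
    with lt have "w j = j" using permutes_not_in[OF assms, of j] by simp
    with lt \<open>w i = i\<close> show False by simp
  next
    case 2
    then have "w j = j" "w i \<in> {1..n}"
      using permutes_not_in[OF assms] permutes_in_image[OF assms] by auto
    with lt 2 show False by auto
  qed
qed

lemma finite_inversions:
  assumes "w permutes {1..n}"
  shows "finite (inversions w)"
  using finite_subset[OF inversions_subset[OF assms]] by simp

lemma inversions_id [simp]: "inversions id = {}"
  by (auto simp: inversions_def)

lemma card_inversions_inv:
  assumes "bij w"
  shows "card (inversions (inv' w)) = card (inversions w)"
proof -
  have w: "w (inv' w q) = q" "inv' w (w q) = q" for q
    using assms by (simp_all add: bij_is_surj surj_f_inv_f bij_is_inj)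
  have "bij_betw (\<lambda>(i, j). (w j, w i)) (inversions w) (inversions (inv' w))"
    by (rule bij_betw_byWitness[where f' = "\<lambda>(i, j). (inv' w j, inv' w i)"])
      (auto simp: inversions_def w)
  then show ?thesis
    by (simp add: bij_betw_same_card)
qed

text \<open>From \<open>x i \<le> Suc i \<le> j\<close> and \<open>x i \<noteq> j\<close> follows
  \<open>x i \<le> j - 1 \<le> x j\<close>, and \<open>x\<close> is injective.\<close>

lemma adjacent_involution_less:
  assumes "adjacent_involution n x" "i < j" "j \<noteq> x i"
  shows "x i < x j"
proof -
  have "x i \<le> Suc i" "j \<le> Suc (x j)" "x (x i) = i" "x (x j) = j"
    using assms(1) unfolding adjacent_involution_def by metis+
  with assms(2,3) have "x i \<noteq> x j" "x j \<noteq> i" by auto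
  with \<open>x i \<le> Suc i\<close> \<open>j \<le> Suc (x j)\<close> assms(2,3) show ?thesis by linarith
qed

lemma finite_adjacent_pairs:
  assumes "adjacent_involution n x"
  shows "finite {i. i < x i \<and> P i}"
proof (rule finite_subset)
  show "{i. i < x i \<and> P i} \<subseteq> {1..n}"
    using assms permutes_not_in unfolding adjacent_involution_def by fastforce
qed simp

text \<open>The involution \<open>x\<close> preserves the order of every pair that it does not swap.\<close>

lemma card_inversions_comp:
  assumes x: "adjacent_involution n x" and z: "z permutes {1..n}"
  shows "card (inversions (z \<circ> x)) + card {i. i < x i \<and> z (x i) < z i}
       = card (inversions z) + card {i. i < x i \<and> z i < z (x i)}"
proof -
  let ?P = "{(i, j). j = x i}"
  have xx: "x (x p) = p" for p
    using x by (simp add: adjacent_involution_def)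
  have xp: "x permutes {1..n}"
    using x by (simp add: adjacent_involution_def)
  have less: "x i < x j" if "i < j" "j \<noteq> x i" for i j
    using adjacent_involution_less[OF x that] .
  have "bij_betw (\<lambda>(i, j). (x i, x j)) (inversions z - ?P) (inversions (z \<circ> x) - ?P)"
    by (rule bij_betw_byWitness[where f' = "\<lambda>(i, j). (x i, x j)"])
      (auto simp: inversions_def xx intro!: less)
  then have a: "card (inversions z - ?P) = card (inversions (z \<circ> x) - ?P)"
    by (rule bij_betw_same_card)
  have "inversions z \<inter> ?P = (\<lambda>i. (i, x i)) ` {i. i < x i \<and> z (x i) < z i}"
    by (auto simp: inversions_def)
  then have b: "card (inversions z \<inter> ?P) = card {i. i < x i \<and> z (x i) < z i}"
    by (simp add: card_image inj_on_def)
  \<comment> \<open>On a swapped pair, composing with \<open>x\<close> exchanges the two values, so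
    the ascents of \<open>z\<close> become the inversions.\<close>
  have "inversions (z \<circ> x) \<inter> ?P = (\<lambda>i. (i, x i)) ` {i. i < x i \<and> z i < z (x i)}"
    by (auto simp: inversions_def xx)
  then have c: "card (inversions (z \<circ> x) \<inter> ?P) = card {i. i < x i \<and> z i < z (x i)}"
    by (simp add: card_image inj_on_def)
  have split: "card A = card (A \<inter> ?P) + card (A - ?P)" if "finite A" for A :: "(nat \<times> nat) set"
    using card_Int_Diff[OF that] .
  show ?thesis
    using split[OF finite_inversions[OF z]] split[OF finite_inversions[OF permutes_compose[OF xp z]]]
      a b c by simp
qed

section \<open>Multiplication by an adjacent transposition\<close>

lemma adjacent_involution_transpose:
  assumes "1 \<le> i" "i < n"
  shows "adjacent_involution n (transpose i (Suc i))"
  using assms permutes_swap_id[of i "{1..n}" "Suc i"]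
  by (auto simp: adjacent_involution_def transpose_def)

lemma transpose_pairs:
  "{k. k < transpose i (Suc i) k \<and> P k (transpose i (Suc i) k)} = (if P i (Suc i) then {i} else {})"
  by (auto simp: transpose_def split: if_splits)

text \<open>A single generator has just one swapped pair, so exactly one inversion is lost or
  gained. The additive form avoids truncated subtraction.\<close>

lemma card_inversions_comp_transpose:
  assumes "z permutes {1..n}" "1 \<le> i" "i < n"
  shows "card (inversions (z \<circ> transpose i (Suc i))) + (if z (Suc i) < z i then 1 else 0)
       = card (inversions z) + (if z i < z (Suc i) then 1 else 0)"
  using card_inversions_comp[OF adjacent_involution_transpose[OF assms(2,3)] assms(1)]
  by (simp add: transpose_pairs[of i "\<lambda>k l. z k < z l"] transpose_pairs[of i "\<lambda>k l. z l < z k"] split: if_splits)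

lemma card_inversions_transpose_comp:
  assumes "z permutes {1..n}" "1 \<le> i" "i < n"
  shows "card (inversions (transpose i (Suc i) \<circ> z)) + (if inv' z (Suc i) < inv' z i then 1 else 0)
       = card (inversions z) + (if inv' z i < inv' z (Suc i) then 1 else 0)"
proof -
  have z: "bij z" by (rule permutes_bij[OF assms(1)])
  then have "inv' (transpose i (Suc i) \<circ> z) = inv' z \<circ> transpose i (Suc i)"
    by (subst o_inv_distrib) (auto simp: bij_def)
  moreover have "bij (transpose i (Suc i) \<circ> z)"
    using z by (rule bij_comp) simp
  ultimately show ?thesis
    using card_inversions_comp_transpose[OF permutes_inv[OF assms(1)] assms(2,3)]
      card_inversions_inv[OF z] card_inversions_inv[of "transpose i (Suc i) \<circ> z"] by simp
qed

text \<open>Without descents \<open>w\<close> is strictly increasing, and so is its inverse. Neither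
  can then lower a point, which leaves only the identity.\<close>

lemma permutes_no_descent:
  assumes w: "w permutes {1..n}" and asc: "\<And>i. 1 \<le> i \<Longrightarrow> i < n \<Longrightarrow> w i < w (Suc i)"
  shows "w = id"
proof -
  \<comment> \<open>Monotonicity on all natural numbers also needs the borders: \<open>w\<close>
    fixes 0 and everything above \<open>n\<close>.\<close>
  have lt: "w i < w (Suc i)" for i
  proof -
    consider "1 \<le> i" "i < n" | "i = 0" | "i \<ge> n" by linarith
    then show ?thesis
    proof cases
      case 1 then show ?thesis by (rule asc)
    next
      case 2
      then have "w i = 0" using permutes_not_in[OF w, of i] by simp
      moreover have "w (Suc i) \<noteq> w i" using permutes_inj[OF w] by (simp add: inj_eq)
      ultimately show ?thesis by simp
    next
      case 3
      then have e: "w (Suc i) = Suc i" using permutes_not_in[OF w] by simp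
      have "w i \<le> i"
        using 3 permutes_in_image[OF w, of i] permutes_not_in[OF w, of i] by (cases "i \<in> {1..n}") auto
      with e show ?thesis by simp
    qed
  qed
  then have mono: "strict_mono w" by (simp add: strict_mono_Suc_iff)
  have "strict_mono (inv' w)"
  proof (rule strict_monoI)
    fix p q :: nat assume "p < q"
    then have "w (inv' w p) < w (inv' w q)" using permutes_inverses(1)[OF w] by simp
    then show "inv' w p < inv' w q" using mono by (simp add: strict_mono_less)
  qed
  have "w p = p" for p
    using strict_mono_imp_increasing[OF mono, of p] strict_mono_imp_increasing[OF \<open>strict_mono (inv' w)\<close>, of "w p"]
      permutes_inverses(2)[OF w] by simp
  then show ?thesis by auto
qed

section \<open>Word length as number of inversions\<close>

lemma card_inversions_le_length:
  assumes "set ws \<subseteq> adj_transpositions n"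
  shows "foldr (\<circ>) ws id permutes {1..n} \<and> card (inversions (foldr (\<circ>) ws id)) \<le> length ws"
  using assms
proof (induction ws)
  case (Cons s ws)
  then obtain i where i: "s = transpose i (Suc i)" "1 \<le> i" "i < n"
    by (auto simp: adj_transpositions_def)
  have "s permutes {1..n}"
    using adjacent_involution_transpose[OF i(2,3)] i(1) by (simp add: adjacent_involution_def)
  moreover have ih: "foldr (\<circ>) ws id permutes {1..n}"
      "card (inversions (foldr (\<circ>) ws id)) \<le> length ws"
    using Cons.IH Cons.prems by (meson set_subset_Cons subset_trans)+
  moreover have e: "foldr (\<circ>) (s # ws) id = s \<circ> foldr (\<circ>) ws id"
    by (subst foldr.simps(2)) (rule o_apply)
  moreover have "card (inversions (s \<circ> foldr (\<circ>) ws id)) \<le> Suc (card (inversions (foldr (\<circ>) ws id)))"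
    using card_inversions_transpose_comp[OF ih(1) i(2,3)] i(1) by (simp split: if_splits)
  ultimately have "s \<circ> foldr (\<circ>) ws id permutes {1..n}"
      and "card (inversions (s \<circ> foldr (\<circ>) ws id)) \<le> length (s # ws)"
    using permutes_compose[OF ih(1)] by (blast, simp)
  then show ?case
    by (subst (1 2) e) (rule conjI)
qed (simp_all add: permutes_id)

text \<open>A descent of the inverse of \<open>w\<close> is a generator whose multiplication from
  the left removes one inversion. Prepending it to a word for the product restores
  \<open>w\<close>.\<close>

lemma ex_reduced_word:
  assumes "w permutes {1..n}"
  shows "\<exists>ws. length ws = card (inversions w) \<and> set ws \<subseteq> adj_transpositions n \<and> foldr (\<circ>) ws id = w"
  using assms
proof (induction "card (inversions w)" arbitrary: w rule: less_induct)
  case less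
  show ?case
  proof (cases "w = id")
    case True
    then show ?thesis by (intro exI[of _ "[]"]) simp
  next
    case False
    have w': "inv' w permutes {1..n}" by (rule permutes_inv[OF less.prems])
    have "inv' w \<noteq> id"
      using False permutes_inv_inv[OF less.prems] by (metis inv_id)
    then obtain i where i: "1 \<le> i" "i < n" "\<not> inv' w i < inv' w (Suc i)"
      using permutes_no_descent[OF w'] by blast
    moreover have "inv' w i \<noteq> inv' w (Suc i)"
      using permutes_inj[OF w'] by (simp add: inj_eq)
    ultimately have *: "card (inversions w) = Suc (card (inversions (transpose i (Suc i) \<circ> w)))"
      using card_inversions_transpose_comp[OF less.prems i(1,2)] by simp
    have "transpose i (Suc i) \<circ> w permutes {1..n}"
      using permutes_compose[OF less.prems] adjacent_involution_transpose[OF i(1,2)]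
      by (simp add: adjacent_involution_def)
    with less.hyps * obtain ws where ws: "length ws = card (inversions (transpose i (Suc i) \<circ> w))"
        "set ws \<subseteq> adj_transpositions n" "foldr (\<circ>) ws id = transpose i (Suc i) \<circ> w"
      by (metis lessI)
    show ?thesis
      using ws * i
      by (intro exI[of _ "transpose i (Suc i) # ws"])
        (auto simp: adj_transpositions_def o_assoc)
  qed
qed

lemma cox_length_eq_card_inversions:
  assumes "w permutes {1..n}"
  shows "cox_length n w = card (inversions w)"
  unfolding cox_length_def word_length_def sym_group_mult sym_group_one
proof (rule Least_equality)
  show "\<exists>ws. length ws = card (inversions w) \<and> set ws \<subseteq> adj_transpositions n \<and> foldr (\<circ>) ws id = w"
    by (rule ex_reduced_word[OF assms])
qed (use card_inversions_le_length in blast)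

section \<open>Involutions of minimal length\<close>

lemma involutions_sym_group:
  "z \<in> involutions (sym_group n) \<longleftrightarrow> z permutes {1..n} \<and> z \<circ> z = id \<and> z \<noteq> id"
proof -
  interpret group "sym_group n" by (rule sym_group_is_group)
  show ?thesis
  proof (cases "z permutes {1..n}")
    case True
    then have z: "z \<in> carrier (sym_group n)" by (simp add: sym_group_carrier)
    have p: "z [^]\<^bsub>sym_group n\<^esub> (2::nat) = z \<circ> z"
      using nat_pow_Suc[of z 1] nat_pow_eone[OF z] by (simp add: numeral_2_eq_2 sym_group_mult)
    \<comment> \<open>The value 0 of \<open>ord\<close> stands for infinite order and is split off,
      since bounding a divisor by 2 is done for positive orders.\<close>
    have "ord z = 2 \<longleftrightarrow> ord z dvd 2 \<and> ord z \<noteq> 1"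
      by (cases "ord z = 0") (auto dest!: dvd_imp_le simp: le_Suc_eq numeral_2_eq_2)
    then show ?thesis
      using z True p pow_eq_id[OF z, of 2] ord_eq_1[OF z]
      by (simp add: involutions_def sym_group_one)
  next
    case False
    then show ?thesis by (simp add: involutions_def sym_group_carrier)
  qed
qed

lemma conj_class_sym_group:
  "y \<in> conj_class (sym_group n) x \<longleftrightarrow> (\<exists>g. g permutes {1..n} \<and> y = g \<circ> x \<circ> inv' g)"
  using sym_group_inv_equality[of _ n]
  by (auto simp del: sym_group_inv_equality simp: conj_class_def sym_group_mult sym_group_carrier) metis+

lemma involution_descent_conj:
  assumes x: "x permutes {1..n}" "\<And>p. x (x p) = p"
    and i: "1 \<le> i" "i < n" "x (Suc i) < x i" "x i \<noteq> Suc i"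
  shows "card (inversions (transpose i (Suc i) \<circ> x \<circ> transpose i (Suc i))) < card (inversions x)"
proof -
  let ?s = "transpose i (Suc i)"
  have ix: "inv' x = x"
    by (rule inv_equality) (simp_all add: x)
  have bx: "bij x" using permutes_bij[OF x(1)] .
  have s: "?s permutes {1..n}"
    using adjacent_involution_transpose[OF i(1,2)] by (simp add: adjacent_involution_def)
  have xs: "x \<circ> ?s permutes {1..n}"
    by (rule permutes_compose[OF s x(1)])
  have 1: "card (inversions x) = Suc (card (inversions (x \<circ> ?s)))"
    using card_inversions_comp_transpose[OF x(1) i(1,2)] i by simp
  have "inv' (x \<circ> ?s) = ?s \<circ> x"
    using bx ix by (subst o_inv_distrib) (auto simp: bij_def)
  \<comment> \<open>The generator reverses only the values \<open>i\<close> and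
    \<open>Suc i\<close>, and \<open>x i \<noteq> Suc i\<close> excludes these. Hence multiplying
    from the left removes a second inversion.\<close>
  moreover have "?s (x (Suc i)) < ?s (x i)"
    using i by (auto simp: transpose_def)
  ultimately have "card (inversions (x \<circ> ?s)) = Suc (card (inversions (?s \<circ> (x \<circ> ?s))))"
    using card_inversions_transpose_comp[OF xs i(1,2)] by simp
  with 1 show ?thesis by (simp add: o_assoc)
qed

text \<open>Conjugating at a descent \<open>i\<close> with \<open>x i \<noteq> Suc i\<close> would
  shorten \<open>x\<close>, so minimality leaves only descents within swapped neighbours. A longer
  jump from \<open>a\<close> to \<open>x a\<close> would need another descent on the way, as
  \<open>x\<close> returns from \<open>x a\<close> to \<open>a\<close>.\<close>

lemma min_length_adjacent_involution:
  assumes "x \<in> involutions (sym_group n)" and min: "min_length_in_class n x"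
  shows "adjacent_involution n x"
proof -
  have x: "x permutes {1..n}" "x (x p) = p" for p
    using assms(1) by (auto simp: involutions_sym_group fun_eq_iff)
  have inj: "x p = x q \<longleftrightarrow> p = q" for p q
    using permutes_inj[OF x(1)] by (simp add: inj_eq)
  have desc: "x i = Suc i" if i: "1 \<le> i" "i < n" "x (Suc i) < x i" for i
  proof (rule ccontr)
    let ?s = "transpose i (Suc i)"
    assume "x i \<noteq> Suc i"
    then have lt: "card (inversions (?s \<circ> x \<circ> ?s)) < card (inversions x)"
      by (rule involution_descent_conj[OF x i])
    have s: "?s permutes {1..n}"
      using adjacent_involution_transpose[OF i(1,2)] by (simp add: adjacent_involution_def)
    have "?s \<circ> x \<circ> ?s permutes {1..n}"
      using s x(1) by (intro permutes_compose)
    moreover have "?s \<circ> x \<circ> ?s \<in> conj_class (sym_group n) x"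
      unfolding conj_class_sym_group using s by (intro exI[of _ ?s]) simp
    ultimately show False
      using min lt cox_length_eq_card_inversions x(1)
      unfolding min_length_in_class_def is_arg_min_def by metis
  qed
  have "x a \<le> Suc a" for a
  proof (rule ccontr)
    assume a: "\<not> x a \<le> Suc a"
    have an: "a \<in> {1..n}" "x a \<in> {1..n}"
      using a permutes_not_in[OF x(1), of a] permutes_in_image[OF x(1), of a] by fastforce+
    text \<open>Between \<open>a\<close> and \<open>x a\<close> there is no descent, so \<open>x\<close> stays above \<open>x a\<close>.\<close>
    have "x (a + j) \<ge> x a" if "a + j \<le> x a" for j
      using that
    proof (induction j)
      case (Suc j)
      then have ge: "x (a + j) \<ge> x a" by simp
      have "x (a + j) \<noteq> Suc (a + j)"
      proof
        assume e: "x (a + j) = Suc (a + j)"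
        with ge Suc.prems have "x (a + j) = x a" by simp
        then have "a + j = a" using inj by blast
        with a e show False by simp
      qed
      then have "\<not> x (Suc (a + j)) < x (a + j)"
        using desc[of "a + j"] an Suc.prems by auto
      then show ?case using ge by simp
    qed simp
    from this[of "x a - a"] a have "x (x a) \<ge> x a" by simp
    with a x(2) show False by simp
  qed
  with x show ?thesis by (simp add: adjacent_involution_def)
qed

section \<open>Double cosets\<close>

text \<open>For an involution \<open>x\<close> of \<open>{1..n}\<close> this is the elementary
  abelian 2-group generated by the transpositions occurring in \<open>x\<close>. The pointwise form
  is easy to carry along a conjugation.\<close>

definition pair_stabilizer :: "nat \<Rightarrow> (nat \<Rightarrow> nat) \<Rightarrow> (nat \<Rightarrow> nat) set"
  where "pair_stabilizer n x = {u. u permutes {1..n} \<and> (\<forall>p. u p = p \<or> u p = x p)}"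

definition same_double_coset :: "nat \<Rightarrow> (nat \<Rightarrow> nat) \<Rightarrow> (nat \<Rightarrow> nat) \<Rightarrow> (nat \<Rightarrow> nat) \<Rightarrow> bool"
  where "same_double_coset n x z z' \<longleftrightarrow>
    (\<exists>u\<in>pair_stabilizer n x. \<exists>v\<in>pair_stabilizer n x. z' = u \<circ> z \<circ> v)"

text \<open>When \<open>x\<close> is an adjacent involution, these \<open>z\<close> are the shortest
  elements of their cosets \<open>z W\<^sub>x\<close>. Imposing the same on the inverse gives the
  shortest elements of double cosets.\<close>

definition increasing_on_pairs :: "(nat \<Rightarrow> nat) \<Rightarrow> (nat \<Rightarrow> nat) \<Rightarrow> bool"
  where "increasing_on_pairs x z \<longleftrightarrow> (\<forall>p. p < x p \<longrightarrow> z p < z (x p))"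

text \<open>Here \<open>z\<close> is its own inverse, so one monotonicity condition serves both
  sides. The identity is kept as the representative of \<open>W\<^sub>x\<close> itself.\<close>

definition increasing_involutions :: "nat \<Rightarrow> (nat \<Rightarrow> nat) \<Rightarrow> (nat \<Rightarrow> nat) set"
  where "increasing_involutions n x = {z. z permutes {1..n} \<and> z \<circ> z = id \<and> increasing_on_pairs x z}"

lemma id_pair_stabilizer: "id \<in> pair_stabilizer n x"
  by (simp add: pair_stabilizer_def permutes_id)

lemma comp_pair_stabilizer:
  assumes "\<And>p. x (x p) = p" "u \<in> pair_stabilizer n x" "v \<in> pair_stabilizer n x"
  shows "u \<circ> v \<in> pair_stabilizer n x"
proof -
  have "u (v p) = p \<or> u (v p) = x p" for p
    using assms unfolding pair_stabilizer_def by (smt (verit) mem_Collect_eq)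
  then show ?thesis
    using assms(2,3) by (auto simp: pair_stabilizer_def intro: permutes_compose)
qed

lemma inv_pair_stabilizer:
  assumes "\<And>p. x (x p) = p" "u \<in> pair_stabilizer n x"
  shows "inv' u \<in> pair_stabilizer n x"
proof -
  have u: "u permutes {1..n}" "u p = p \<or> u p = x p" for p
    using assms(2) by (auto simp: pair_stabilizer_def)
  have "inv' u p = p \<or> inv' u p = x p" for p
    using u(2)[of "inv' u p"] permutes_inverses(1)[OF u(1), of p] assms(1) by metis
  then show ?thesis
    using permutes_inv[OF u(1)] by (simp add: pair_stabilizer_def)
qed

lemma transpose_pair_stabilizer:
  assumes "x permutes {1..n}" "\<And>p. x (x p) = p" "a < x a"
  shows "transpose a (x a) \<in> pair_stabilizer n x"
proof -
  have "a \<in> {1..n}"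
    using permutes_not_in[OF assms(1), of a] assms(3) by force
  then have "transpose a (x a) permutes {1..n}"
    using permutes_in_image[OF assms(1)] by (intro permutes_swap_id) auto
  then show ?thesis
    using assms(2) by (auto simp: pair_stabilizer_def transpose_def)
qed

lemma same_double_coset_permutes:
  assumes "same_double_coset n x z z'" "z permutes {1..n}"
  shows "z' permutes {1..n}"
  using assms by (auto simp: same_double_coset_def pair_stabilizer_def intro!: permutes_compose)

lemma same_double_coset_refl: "same_double_coset n x z z"
  unfolding same_double_coset_def using id_pair_stabilizer comp_id id_comp by metis

lemma same_double_coset_sym:
  assumes "\<And>p. x (x p) = p" "same_double_coset n x z z'"
  shows "same_double_coset n x z' z"
proof -
  obtain u v where uv: "u \<in> pair_stabilizer n x" "v \<in> pair_stabilizer n x" "z' = u \<circ> z \<circ> v"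
    using assms(2) by (auto simp: same_double_coset_def)
  then have "u permutes {1..n}" "v permutes {1..n}"
    by (auto simp: pair_stabilizer_def)
  then have "z = inv' u \<circ> z' \<circ> inv' v"
    using uv(3) by (auto simp: fun_eq_iff permutes_inverses)
  then show ?thesis
    using inv_pair_stabilizer[OF assms(1)] uv unfolding same_double_coset_def by blast
qed

lemma same_double_coset_trans:
  assumes "\<And>p. x (x p) = p" "same_double_coset n x z z'" "same_double_coset n x z' z''"
  shows "same_double_coset n x z z''"
proof -
  obtain u v u' v' where uv: "u \<in> pair_stabilizer n x" "v \<in> pair_stabilizer n x" "z' = u \<circ> z \<circ> v"
    "u' \<in> pair_stabilizer n x" "v' \<in> pair_stabilizer n x" "z'' = u' \<circ> z' \<circ> v'"
    using assms(2,3) by (auto simp: same_double_coset_def)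
  then have "z'' = (u' \<circ> u) \<circ> z \<circ> (v \<circ> v')"
    by (simp add: o_assoc)
  then show ?thesis
    using comp_pair_stabilizer[OF assms(1)] uv unfolding same_double_coset_def by blast
qed

lemma same_double_coset_inv:
  assumes "\<And>p. x (x p) = p" "same_double_coset n x z z'" "z permutes {1..n}"
  shows "same_double_coset n x (inv' z) (inv' z')"
proof -
  obtain u v where uv: "u \<in> pair_stabilizer n x" "v \<in> pair_stabilizer n x" "z' = u \<circ> z \<circ> v"
    using assms(2) by (auto simp: same_double_coset_def)
  then have "bij u" "bij v" "bij z"
    using assms(3) by (auto simp: pair_stabilizer_def permutes_bij)
  then have "inv' z' = inv' v \<circ> inv' z \<circ> inv' u"
    unfolding uv(3) by (simp add: o_inv_distrib bij_comp o_assoc)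
  then show ?thesis
    using inv_pair_stabilizer[OF assms(1)] uv unfolding same_double_coset_def by blast
qed

text \<open>
  Sending a point to the smaller element of its pair is monotone. Hence the pair containing
  \<open>z p\<close> is a weakly increasing function of \<open>p\<close> on each pair, so the double coset determines it, and
  monotonicity of the inverses then determines \<open>z p\<close> itself.
\<close>

lemma double_coset_increasing_unique:
  assumes x: "adjacent_involution n x"
    and z: "z permutes {1..n}" "increasing_on_pairs x z" "increasing_on_pairs x (inv' z)"
    and z': "z' permutes {1..n}" "increasing_on_pairs x z'" "increasing_on_pairs x (inv' z')"
    and zz': "same_double_coset n x z z'"
  shows "z = z'"
proof -
  define b where "b p = min p (x p)" for p
  have xx: "x (x p) = p" and xS: "x p \<le> Suc p" for p
    using x by (auto simp: adjacent_involution_def)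
  have xp: "x permutes {1..n}"
    using x by (auto simp: adjacent_involution_def)
  have bx: "b (x p) = b p" for p
    by (auto simp: b_def xx)
  have b_eq: "b p = b q \<Longrightarrow> q = p \<or> q = x p" for p q
    unfolding b_def min_def by (metis xx)
  \<comment> \<open>Since \<open>x q\<close> is at least \<open>q - 1\<close>, both \<open>q\<close>
    and \<open>x q\<close> are at least \<open>p\<close>, hence at least \<open>b p\<close>.\<close>
  have b_mono: "b p \<le> b q" if "p < q" for p q
    using that xS[of "x q"] xx[of q] by (auto simp: b_def)
  obtain u v where u: "u \<in> pair_stabilizer n x" and v: "v \<in> pair_stabilizer n x"
    and uv: "z' = u \<circ> z \<circ> v"
    using zz' by (auto simp: same_double_coset_def)
  have "u p = p \<or> u p = x p" for p
    using u by (auto simp: pair_stabilizer_def)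
  then have bu: "b (u p) = b p" for p
    using bx by metis
  have v_cases: "v p = p \<or> v p = x p" for p
    using v by (auto simp: pair_stabilizer_def)
  have v_inj: "v p = v q \<Longrightarrow> p = q" for p q
    using v permutes_inj by (auto simp: pair_stabilizer_def dest: injD)
  have bz': "b (z' p) = b (z (v p))" for p
    by (simp add: uv bu)
  have swap: "b (z' p) = b (z p) \<and> b (z' (x p)) = b (z (x p))" if "p < x p" for p
  proof (cases "v p = p")
    case True
    then have "v (x p) = x p"
      using v_cases[of "x p"] v_inj[of "x p" p] xx that by auto
    with True show ?thesis by (simp add: bz')
  next
    case False
    then have "v p = x p" using v_cases by blast
    moreover from this have "v (x p) = p"
      using v_cases[of "x p"] v_inj[of "x p" p] xx that by auto
    \<comment> \<open>As \<open>v\<close> swaps the pair, the second inequality is the reverse of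
      the first, so all four values agree.\<close>
    moreover have "b (z p) \<le> b (z (x p))" "b (z' p) \<le> b (z' (x p))"
      using z(2) z'(2) that by (auto simp: increasing_on_pairs_def intro!: b_mono)
    ultimately show ?thesis by (simp add: bz')
  qed
  have same_pair: "b (z' p) = b (z p)" for p
  proof -
    consider "p < x p" | "x p < x (x p)" | "x p = p"
      using xx by (metis linorder_neqE_nat)
    then show ?thesis
    proof cases
      case 1 then show ?thesis using swap by blast
    next
      case 2 then show ?thesis using swap[of "x p"] xx by simp
    next
      case 3
      then have "v p = p" using v_cases[of p] by auto
      then show ?thesis by (simp add: bz')
    qed
  qed
  have pts: "z' p = z p \<or> z' p = x (z p)" for p
    by (rule b_eq) (simp add: same_pair)
  have "z p = z' p" for p
  proof (rule ccontr)
    assume ne: "z p \<noteq> z' p"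
    define q where "q = z p"
    \<comment> \<open>At \<open>p'\<close> the map \<open>z\<close> takes the other element of the
      pair of \<open>q\<close>. So \<open>z\<close> and \<open>z'\<close> exchange their values at
      \<open>p\<close> and \<open>p'\<close>, and their inverses order these points
      oppositely.\<close>
    define p' where "p' = inv' z (x q)"
    have q: "z' p = x q" "x q \<noteq> q"
      using pts[of p] ne by (auto simp: q_def)
    have zp': "z p' = x q"
      using permutes_inverses(1)[OF z(1)] by (simp add: p'_def)
    then have "p' \<noteq> p" using q by (auto simp: q_def)
    then have "z' p' \<noteq> x q"
      using q(1) permutes_inj[OF z'(1)] by (metis injD)
    then have "z' p' = q"
      using pts[of p'] zp' xx by auto
    then have i: "inv' z q = p" "inv' z (x q) = p'" "inv' z' q = p'" "inv' z' (x q) = p"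
      using q zp' permutes_inverses(2)[OF z(1)] permutes_inverses(2)[OF z'(1)]
      by (metis q_def)+
    show False
    proof (cases "q < x q")
      case True
      with z(3) z'(3) i show False
        by (metis increasing_on_pairs_def less_asym)
    next
      case False
      with q(2) have "x q < x (x q)" by (simp add: xx)
      with z(3) z'(3) i show False
        by (metis increasing_on_pairs_def less_asym xx)
    qed
  qed
  then show ?thesis by auto
qed

section \<open>Existence of increasing representatives\<close>

lemma card_inversions_comp_pair:
  assumes x: "adjacent_involution n x" and z: "z permutes {1..n}" and a: "a < x a" "\<not> z a < z (x a)"
  shows "card (inversions (z \<circ> transpose a (x a))) < card (inversions z)"
proof -
  have xa: "x a = Suc a" and xp: "x permutes {1..n}"
    using x a(1) unfolding adjacent_involution_def by (metis Suc_leI le_antisym, blast)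
  have "a \<in> {1..n}" using permutes_not_in[OF xp, of a] a(1) by force
  moreover from this have "x a \<in> {1..n}" using permutes_in_image[OF xp] by simp
  ultimately have "1 \<le> a" "a < n" using xa by auto
  moreover have "z a \<noteq> z (Suc a)"
    using permutes_inj[OF z] by (simp add: inj_eq)
  ultimately show ?thesis
    using card_inversions_comp_transpose[OF z, of a] a(2) xa by simp
qed

text \<open>An element of the double coset with fewest inversions works: a descent of it, or of its
  inverse, on a pair could be removed by a transposition from \<open>W\<^sub>x\<close> on the right
  or left.\<close>

lemma double_coset_increasing_exists:
  assumes x: "adjacent_involution n x" and z: "z permutes {1..n}"
  obtains z' where "same_double_coset n x z z'" "increasing_on_pairs x z'"
    "increasing_on_pairs x (inv' z')"
proof -
  have xx: "x (x p) = p" and xp: "x permutes {1..n}" for p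
    using x by (auto simp: adjacent_involution_def)
  obtain z' where z': "same_double_coset n x z z'"
    and min: "\<And>w. same_double_coset n x z w \<Longrightarrow> card (inversions z') \<le> card (inversions w)"
    using ex_has_least_nat[of "same_double_coset n x z" z "\<lambda>w. card (inversions w)"]
      same_double_coset_refl by blast
  have pz': "z' permutes {1..n}" using same_double_coset_permutes[OF z' z] .
  have "z' a < z' (x a)" if a: "a < x a" for a
  proof (rule ccontr)
    assume "\<not> z' a < z' (x a)"
    then have "card (inversions (z' \<circ> transpose a (x a))) < card (inversions z')"
      by (rule card_inversions_comp_pair[OF x pz' a])
    moreover have "same_double_coset n x z' (z' \<circ> transpose a (x a))"
      using transpose_pair_stabilizer[OF xp xx a] id_pair_stabilizer
      unfolding same_double_coset_def using comp_id id_comp by metis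
    ultimately show False
      using min same_double_coset_trans[OF xx z'] by (metis not_le)
  qed
  moreover have "inv' z' a < inv' z' (x a)" if a: "a < x a" for a
  proof (rule ccontr)
    let ?t = "transpose a (x a)"
    assume "\<not> inv' z' a < inv' z' (x a)"
    then have "card (inversions (inv' z' \<circ> ?t)) < card (inversions (inv' z'))"
      by (rule card_inversions_comp_pair[OF x permutes_inv[OF pz'] a])
    moreover have b: "bij z'" using permutes_bij[OF pz'] .
    moreover have "inv' z' \<circ> ?t = inv' (?t \<circ> z')"
      using b by (simp add: o_inv_distrib)
    moreover have "bij (?t \<circ> z')" using b by (rule bij_comp) simp
    ultimately have "card (inversions (?t \<circ> z')) < card (inversions z')"
      by (simp add: card_inversions_inv)
    moreover have "same_double_coset n x z' (?t \<circ> z')"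
      using transpose_pair_stabilizer[OF xp xx a] id_pair_stabilizer
      unfolding same_double_coset_def using comp_id id_comp by metis
    ultimately show False
      using min same_double_coset_trans[OF xx z'] by (metis not_le)
  qed
  ultimately show ?thesis
    using that z' by (simp add: increasing_on_pairs_def)
qed

lemma involution_inv_eq:
  assumes "z \<circ> z = id"
  shows "inv' z = z"
  using assms by (intro inv_unique_comp)

text \<open>The double coset of an involution is closed under inversion, so the increasing
  representative and its inverse both lie in it. Uniqueness makes them equal.\<close>

lemma double_coset_increasing_involution_exists:
  assumes x: "adjacent_involution n x" and z: "z permutes {1..n}" "z \<circ> z = id"
  obtains z' where "same_double_coset n x z z'" "z' \<in> increasing_involutions n x"
proof -
  have xx: "x (x p) = p" for p
    using x by (auto simp: adjacent_involution_def)
  obtain z' where z': "same_double_coset n x z z'" "increasing_on_pairs x z'"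
      "increasing_on_pairs x (inv' z')"
    using double_coset_increasing_exists[OF x z(1)] .
  have pz': "z' permutes {1..n}" using same_double_coset_permutes[OF z'(1) z(1)] .
  have "same_double_coset n x z (inv' z')"
    using same_double_coset_inv[OF xx z'(1) z(1)] involution_inv_eq[OF z(2)] by simp
  then have "same_double_coset n x z' (inv' z')"
    using same_double_coset_trans[OF xx same_double_coset_sym[OF xx z'(1)]] by blast
  then have "z' = inv' z'"
    using z'(2,3) pz'
    by (intro double_coset_increasing_unique[OF x]) (simp_all add: permutes_inv permutes_inv_inv)
  then have "z' \<circ> z' = id"
    using permutes_inv_o(1)[OF pz'] by simp
  with that z' pz' show ?thesis by (simp add: increasing_involutions_def)
qed

section \<open>Transport along a conjugation\<close>

lemma same_double_coset_conj:
  assumes h: "h permutes {1..n}" and zz': "same_double_coset n x z z'"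
  shows "same_double_coset n (h \<circ> x \<circ> inv' h) (h \<circ> z \<circ> inv' h) (h \<circ> z' \<circ> inv' h)"
proof -
  note hh = permutes_inverses[OF h]
  obtain u v where uv: "u \<in> pair_stabilizer n x" "v \<in> pair_stabilizer n x" "z' = u \<circ> z \<circ> v"
    using zz' by (auto simp: same_double_coset_def)
  have conj: "h \<circ> w \<circ> inv' h \<in> pair_stabilizer n (h \<circ> x \<circ> inv' h)"
    if w: "w \<in> pair_stabilizer n x" for w
  proof -
    have "h (w (inv' h p)) = p \<or> h (w (inv' h p)) = h (x (inv' h p))" for p
    proof -
      have "w (inv' h p) = inv' h p \<or> w (inv' h p) = x (inv' h p)"
        using w by (simp add: pair_stabilizer_def)
      then show ?thesis using hh by auto
    qed
    then show ?thesis
      using w h permutes_inv[OF h] by (auto simp: pair_stabilizer_def intro!: permutes_compose)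
  qed
  have "h \<circ> z' \<circ> inv' h = (h \<circ> u \<circ> inv' h) \<circ> (h \<circ> z \<circ> inv' h) \<circ> (h \<circ> v \<circ> inv' h)"
    by (simp add: uv(3) fun_eq_iff hh)
  then show ?thesis
    using conj uv unfolding same_double_coset_def by blast
qed

text \<open>Conjugate by \<open>h\<close>, then pass to the increasing representative. This is
  injective: equal images give one double coset for \<open>y\<close>, and conjugating back gives one
  for \<open>x\<close>. Equality of cardinalities will come from using \<open>h\<close> and its
  inverse.\<close>

lemma card_increasing_involutions_le:
  assumes x: "adjacent_involution n x" and y: "adjacent_involution n y"
    and h: "h permutes {1..n}" and yh: "y = h \<circ> x \<circ> inv' h"
  shows "card (increasing_involutions n x) \<le> card (increasing_involutions n y)"
proof -
  note hh = permutes_inverses[OF h]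
  have yy: "y (y p) = p" for p
    using y by (auto simp: adjacent_involution_def)
  have xh: "x = inv' h \<circ> y \<circ> inv' (inv' h)"
    by (simp add: yh fun_eq_iff hh permutes_inv_inv[OF h])
  have ex: "\<exists>z'. same_double_coset n y (h \<circ> z \<circ> inv' h) z' \<and> z' \<in> increasing_involutions n y"
    if z: "z \<in> increasing_involutions n x" for z
  proof -
    have "h \<circ> z \<circ> inv' h permutes {1..n}"
      using z h permutes_inv[OF h] by (auto simp: increasing_involutions_def intro!: permutes_compose)
    moreover have "(h \<circ> z \<circ> inv' h) \<circ> (h \<circ> z \<circ> inv' h) = id"
      using z by (simp add: increasing_involutions_def fun_eq_iff hh)
    ultimately show ?thesis
      using double_coset_increasing_involution_exists[OF y] by metis
  qed
  then obtain f where f: "\<And>z. z \<in> increasing_involutions n x \<Longrightarrow>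
      same_double_coset n y (h \<circ> z \<circ> inv' h) (f z) \<and> f z \<in> increasing_involutions n y"
    by metis
  show ?thesis
  proof (rule card_inj_on_le)
    show "inj_on f (increasing_involutions n x)"
    proof (rule inj_onI)
      fix z w assume z: "z \<in> increasing_involutions n x" and w: "w \<in> increasing_involutions n x"
        and eq: "f z = f w"
      have "same_double_coset n y (h \<circ> z \<circ> inv' h) (h \<circ> w \<circ> inv' h)"
        using f[OF z] f[OF w] eq same_double_coset_sym[OF yy] same_double_coset_trans[OF yy] by metis
      from same_double_coset_conj[OF permutes_inv[OF h] this, folded xh]
      have "same_double_coset n x z w"
        by (simp add: o_def hh permutes_inv_inv[OF h])
      then show "z = w"
        using z w involution_inv_eq[of z] involution_inv_eq[of w]
        by (intro double_coset_increasing_unique[OF x]) (auto simp: increasing_involutions_def)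
    qed
    show "f ` increasing_involutions n x \<subseteq> increasing_involutions n y"
      using f by blast
    show "finite (increasing_involutions n y)"
      by (rule finite_subset[OF _ finite_permutations[of "{1..n}"]])
        (auto simp: increasing_involutions_def)
  qed
qed

section \<open>Additivity of length and the set \<open>Delta1\<close>\<close>

lemma card_inversions_add_iff:
  assumes x: "adjacent_involution n x" and z: "z permutes {1..n}"
  shows "card (inversions (z \<circ> x)) = card (inversions x) + card (inversions z)
    \<longleftrightarrow> increasing_on_pairs x z"
proof -
  let ?A = "{i. i < x i \<and> z i < z (x i)}" and ?D = "{i. i < x i \<and> z (x i) < z i}"
  have fin: "finite ?A" "finite ?D"
    using finite_adjacent_pairs[OF x, of "\<lambda>i. z i < z (x i)"]
      finite_adjacent_pairs[OF x, of "\<lambda>i. z (x i) < z i"] by auto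
  have ne: "z i \<noteq> z (x i)" if "i < x i" for i
    using permutes_inj[OF z] that by (simp add: inj_eq)
  have "card (inversions x) = card {i. i < x i}"
    using card_inversions_comp[OF x permutes_id] by (simp cong: conj_cong)
  also have "{i. i < x i} = ?A \<union> ?D"
    using ne by (auto simp: nat_neq_iff)
  also have "card \<dots> = card ?A + card ?D"
    using fin by (intro card_Un_disjoint) auto
  \<comment> \<open>The length of the product falls short of the sum by twice the number of descents
    of \<open>z\<close> on pairs.\<close>
  finally have "card (inversions (z \<circ> x)) = card (inversions x) + card (inversions z) \<longleftrightarrow> card ?D = 0"
    using card_inversions_comp[OF x z] by linarith
  also have "\<dots> \<longleftrightarrow> (\<forall>i. i < x i \<longrightarrow> \<not> z (x i) < z i)"
    using fin by simp
  also have "\<dots> \<longleftrightarrow> increasing_on_pairs x z"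
    unfolding increasing_on_pairs_def using ne by (metis less_asym linorder_neqE_nat)
  finally show ?thesis .
qed

text \<open>For involutions \<open>x \<circ> z\<close> and \<open>z \<circ> x\<close> are mutually
  inverse and have equally many inversions. Order exactly 2 is what removes
  \<open>id\<close>.\<close>

lemma Delta1_adjacent_involution:
  assumes x: "adjacent_involution n x"
  shows "Delta1 n x = increasing_involutions n x - {id}"
proof -
  have "cox_length n (x \<circ> z) = cox_length n x + cox_length n z \<longleftrightarrow> increasing_on_pairs x z"
    if z: "z permutes {1..n}" "z \<circ> z = id" for z
  proof -
    have xp: "x permutes {1..n}" and "x \<circ> x = id"
      using x by (auto simp: adjacent_involution_def)
    then have "inv' (x \<circ> z) = z \<circ> x"
      using z by (simp add: o_inv_distrib permutes_bij involution_inv_eq)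
    moreover have xz: "x \<circ> z permutes {1..n}"
      using permutes_compose[OF z(1) xp] .
    ultimately show ?thesis
      using card_inversions_inv[OF permutes_bij[OF xz]] card_inversions_add_iff[OF x z(1)]
        cox_length_eq_card_inversions[OF xz] cox_length_eq_card_inversions[OF xp]
        cox_length_eq_card_inversions[OF z(1)]
      by simp
  qed
  then show ?thesis
    by (auto simp: Delta1_def involutions_sym_group sym_group_mult increasing_involutions_def)
qed

theorem lemma4p5:
  fixes n :: nat and x y :: "nat \<Rightarrow> nat"
  assumes "x \<in> involutions (sym_group n)"
    and "y \<in> involutions (sym_group n)"
    and "y \<in> conj_class (sym_group n) x"
    and "min_length_in_class n x"
    and "min_length_in_class n y"
  shows "card (Delta1 n x) = card (Delta1 n y)"
proof -
  have x: "adjacent_involution n x" and y: "adjacent_involution n y"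
    using assms min_length_adjacent_involution by blast+
  obtain h where h: "h permutes {1..n}" "y = h \<circ> x \<circ> inv' h"
    using assms(3) by (auto simp: conj_class_sym_group)
  have xh: "x = inv' h \<circ> y \<circ> inv' (inv' h)"
    by (simp add: h(2) fun_eq_iff permutes_inverses[OF h(1)] permutes_inv_inv[OF h(1)])
  have "card (increasing_involutions n x) = card (increasing_involutions n y)"
    using card_increasing_involutions_le[OF x y h]
      card_increasing_involutions_le[OF y x permutes_inv[OF h(1)] xh] by simp
  \<comment> \<open>Discarding \<open>id\<close> therefore lowers both cardinalities by one.\<close>
  moreover have "id \<in> increasing_involutions n w" for w
    by (simp add: increasing_involutions_def increasing_on_pairs_def permutes_id)
  ultimately show ?thesis
    by (simp add: Delta1_adjacent_involution x y card_Diff_singleton)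
qed

end
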